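(* Let $a<b$ be real numbers, let $p:[a,b]\to[1,+\infty)$ be Lebesgue integrable and essentially bounded, and let $f\in WBV_{p(\cdot)}[a,b]$. Then the set of points of discontinuity of $f$ is at most countable.
   Context: For a nondegenerate closed interval $Q=[s,t]\subset[a,b]$ put $f(Q):=f(t)-f(s)$, $|Q|=t-s$, and $\bar p(Q):=\left(\frac{1}{|Q|}\int_Q\frac{1}{p(x)}\,dx\right)^{-1}$. A finite partition of $[a,b]$ is a family $P=\{Q_k\}_{k=1}^n$ with $Q_k=[t_{k-1},t_k]$ and $a=t_0<\dots<t_n=b$; $\Pi[a,b]$ is the set of all finite partitions. Define $$V_a^b(p,f):=\sup_{P\in\Pi[a,b]}\sum_{k=1}^n|f(Q_k)|^{\bar p(Q_k)}\in[0,+\infty],$$ $$\|f\|_{WBV_{p(\cdot)}}:=\inf\{\lambda>0: V_a^b(p,f/\lambda)\le 1\}\quad(\inf\emptyset=+\infty),$$ $$WBV_{p(\cdot)}[a,b]:=\{f:[a,b]\to\mathbb{R}: f(a)=0,\ \|f\|_{WBV_{p(\cdot)}}<+\infty\}.$$ *)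

theory Defs
  imports "HOL-Analysis.Analysis"
begin

text \<open>
  Functions on \<open>[a,b]\<close> are represented by total functions \<open>real \<Rightarrow> real\<close>; the definitions below,
  for partitions of \<open>[a,b]\<close>, only inspect their values on \<open>{a..b}\<close>.
\<close>

definition mean_exponent :: "(real \<Rightarrow> real) \<Rightarrow> real \<Rightarrow> real \<Rightarrow> real" where
  "mean_exponent p s t = inverse (1 / (t - s) * (LINT x:{s..t}|lebesgue. 1 / p x))"

text \<open>The pair \<open>(n, t)\<close> encodes the partition with nodes \<open>t 0 < \<dots> < t n\<close>; values of \<open>t\<close> beyond
  \<open>n\<close> are irrelevant.\<close>

definition partitions :: "real \<Rightarrow> real \<Rightarrow> (nat \<times> (nat \<Rightarrow> real)) set" where
  "partitions a b = {(n, t). t 0 = a \<and> t n = b \<and> (\<forall>k<n. t k < t (Suc k))}"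

definition wiener_variation ::
    "real \<Rightarrow> real \<Rightarrow> (real \<Rightarrow> real) \<Rightarrow> (real \<Rightarrow> real) \<Rightarrow> ennreal" where
  "wiener_variation a b p f =
     (SUP (n, t) \<in> partitions a b.
        ennreal (\<Sum>k<n. \<bar>f (t (Suc k)) - f (t k)\<bar> powr mean_exponent p (t k) (t (Suc k))))"

text \<open>In \<open>ennreal\<close> the infimum of the empty set is \<open>\<infinity>\<close>.\<close>

definition wbv_norm ::
    "real \<Rightarrow> real \<Rightarrow> (real \<Rightarrow> real) \<Rightarrow> (real \<Rightarrow> real) \<Rightarrow> ennreal" where
  "wbv_norm a b p f =
     Inf {ennreal l | l :: real. l > 0 \<and> wiener_variation a b p (\<lambda>x. f x / l) \<le> 1}"

definition WBV :: "real \<Rightarrow> real \<Rightarrow> (real \<Rightarrow> real) \<Rightarrow> (real \<Rightarrow> real) set" where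
  "WBV a b p = {f. f a = 0 \<and> wbv_norm a b p f < \<infinity>}"

definition essentially_bounded_on :: "real set \<Rightarrow> (real \<Rightarrow> real) \<Rightarrow> bool" where
  "essentially_bounded_on S p \<longleftrightarrow> (\<exists>M. AE x in lebesgue. x \<in> S \<longrightarrow> \<bar>p x\<bar> \<le> M)"

end

theory Submission
  imports Defs
begin

text \<open>
  After rescaling, \<open>g = f / l\<close> has finite variation on \<open>[a,b]\<close>. The running variation
  \<open>\<phi>(x) = V\<^sub>a\<^sup>x(p,g)\<close> is then a finite increasing function, so it has at most countably many
  discontinuities. Appending the interval \<open>[s,t]\<close> to a partition of \<open>[a,s]\<close> shows
  (\<open>wiener_variation_superadditive\<close>) that the increments of \<open>\<phi>\<close> control those of \<open>g\<close>:
  \<open>\<bar>g(t) - g(s)\<bar>\<close>, raised to the mean exponent of \<open>[s,t]\<close>, is at most \<open>\<phi>(t) - \<phi>(s)\<close>.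
  The mean exponents stay below an essential bound of \<open>p\<close>, so a small increment of \<open>\<phi>\<close>
  forces a small increment of \<open>g\<close>, uniformly in the interval. Hence \<open>g\<close>, and with it \<open>f\<close>,
  is continuous wherever \<open>\<phi>\<close> is
  (\<open>countable_discontinuities_of_finite_variation\<close>).
\<close>

lemma mean_exponent_nonneg:
  assumes "s < t" and "\<And>x. x \<in> {s..t} \<Longrightarrow> 0 \<le> p x"
  shows "0 \<le> mean_exponent p s t"
proof -
  have "0 \<le> (LINT x:{s..t}|lebesgue. 1 / p x)"
    unfolding set_lebesgue_integral_def
    by (rule integral_nonneg_AE) (use assms in \<open>auto simp: indicator_def\<close>)
  then show ?thesis
    using assms(1) unfolding mean_exponent_def by simp
qed

text \<open>
  The mean exponent is the harmonic mean of \<open>p\<close>, so an essential upper bound of \<open>p\<close> carries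
  over to it. The lower bound on \<open>p\<close> makes \<open>1 / p\<close> bounded and hence integrable; for a
  non-integrable \<open>1 / p\<close> the integral would take the default value \<open>0\<close> and give no
  comparison with \<open>1 / M\<close>.
\<close>

lemma mean_exponent_le:
  assumes "s < t" and p: "\<And>x. x \<in> {s..t} \<Longrightarrow> 1 \<le> p x"
    and meas: "set_borel_measurable lebesgue {s..t} p"
    and bound: "AE x in lebesgue. x \<in> {s..t} \<longrightarrow> p x \<le> M"
    and "0 < M"
  shows "mean_exponent p s t \<le> M"
proof -
  \<comment> \<open>Outside \<open>{s..t}\<close> both sides are \<open>0\<close> because \<open>inverse 0 = 0\<close>.\<close>
  have cut: "(\<lambda>x. indicator {s..t} x *\<^sub>R (1 / p x))
      = (\<lambda>x. inverse (indicator {s..t} x *\<^sub>R p x))"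
    by (auto simp: indicator_def divide_inverse)
  have "(\<lambda>x. indicator {s..t} x *\<^sub>R (1 / p x)) \<in> borel_measurable lebesgue"
    unfolding cut using meas unfolding set_borel_measurable_def by measurable
  moreover have one: "set_integrable lebesgue {s..t} (\<lambda>x. 1 :: real)"
    by (simp add: set_integrable_def flip: lmeasurable_iff_integrable)
  ultimately have int: "set_integrable lebesgue {s..t} (\<lambda>x. 1 / p x)"
    unfolding set_integrable_def
    by (rule_tac Bochner_Integration.integrable_bound)
      (use p in \<open>force simp: indicator_def\<close>)+
  have "(LINT x:{s..t}|lebesgue. 1 / M) \<le> (LINT x:{s..t}|lebesgue. 1 / p x)"
  proof (rule set_integral_mono_AE)
    show "set_integrable lebesgue {s..t} (\<lambda>x. 1 / M)"
      using set_integrable_mult_right[OF one, of "1 / M"] by simp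
    show "AE x\<in>{s..t} in lebesgue. 1 / M \<le> 1 / p x"
      using bound
    proof eventually_elim
      case (elim x)
      show ?case using elim p[of x] by (auto intro!: divide_left_mono)
    qed
  qed (rule int)
  moreover have "(LINT x:{s..t}|lebesgue. 1 / M) = (t - s) / M"
    using \<open>s < t\<close> by (simp add: set_lebesgue_integral_def)
  ultimately have "1 / M \<le> 1 / (t - s) * (LINT x:{s..t}|lebesgue. 1 / p x)"
    using \<open>s < t\<close> \<open>0 < M\<close> by (simp add: field_simps)
  then show ?thesis
    unfolding mean_exponent_def using \<open>0 < M\<close>
    by (metis inverse_eq_divide inverse_inverse_eq le_imp_inverse_le zero_less_divide_1_iff)
qed

lemma partitions_nonempty:
  assumes "a \<le> s"
  shows "partitions a s \<noteq> {}"
proof (cases "a = s")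
  case True
  then have "(0, \<lambda>_. a) \<in> partitions a s" by (simp add: partitions_def)
  then show ?thesis by blast
next
  case False
  then have "(1, \<lambda>k. if k = 0 then a else s) \<in> partitions a s"
    using assms by (simp add: partitions_def)
  then show ?thesis by blast
qed

text \<open>
  A partition of \<open>[a,s]\<close> extended by the node \<open>t\<close> is one of the partitions of \<open>[a,t]\<close>, and its
  sum gains exactly the term of the last interval; take the supremum over the partitions of
  \<open>[a,s]\<close>. For \<open>a = s\<close> the only partition is the one with a single node and sum \<open>0\<close>.
\<close>

lemma wiener_variation_superadditive:
  assumes "a \<le> s" "s < t"
  shows "wiener_variation a s p f + ennreal (\<bar>f t - f s\<bar> powr mean_exponent p s t)
         \<le> wiener_variation a t p f"
proof -
  let ?S = "\<lambda>n u. (\<Sum>k<n. \<bar>f (u (Suc k)) - f (u k)\<bar> powr mean_exponent p (u k) (u (Suc k)))"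
  let ?d = "\<bar>f t - f s\<bar> powr mean_exponent p s t"
  have "wiener_variation a s p f + ennreal ?d
      = (SUP (n, u) \<in> partitions a s. ennreal (?S n u) + ennreal ?d)"
    unfolding wiener_variation_def case_prod_beta
    using partitions_nonempty[OF assms(1)] by (rule ennreal_SUP_add_left[symmetric])
  also have "\<dots> \<le> wiener_variation a t p f"
  proof (rule SUP_least, clarify)
    fix n u assume u: "(n, u) \<in> partitions a s"
    define v where "v = (\<lambda>k. if k \<le> n then u k else t)"
    have v: "(Suc n, v) \<in> partitions a t"
      using u assms by (auto simp: partitions_def v_def less_Suc_eq)
    have "?S (Suc n) v = ?S n u + ?d"
      using u by (simp add: v_def partitions_def)
    then have "ennreal (?S n u) + ennreal ?d = ennreal (?S (Suc n) v)"
      by (simp add: ennreal_plus sum_nonneg)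
    also have "\<dots> \<le> wiener_variation a t p f"
      unfolding wiener_variation_def
      using SUP_upper[OF v, of "\<lambda>(n, u). ennreal (?S n u)"] by simp
    finally show "ennreal (?S n u) + ennreal ?d \<le> wiener_variation a t p f" .
  qed
  finally show ?thesis .
qed

lemma wiener_variation_mono:
  assumes "a \<le> s" "s \<le> t"
  shows "wiener_variation a s p f \<le> wiener_variation a t p f"
proof (cases "s = t")
  case False
  have "wiener_variation a s p f
      \<le> wiener_variation a s p f + ennreal (\<bar>f t - f s\<bar> powr mean_exponent p s t)"
    by simp
  also have "\<dots> \<le> wiener_variation a t p f"
    using wiener_variation_superadditive False assms by simp
  finally show ?thesis .
qed simp

text \<open>
  At a point of continuity of the running variation, an increment of \<open>f\<close> of size at least
  \<open>c < 1\<close> over an arbitrarily short interval would contribute at least \<open>c powr M\<close> to the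
  running variation, whatever the mean exponent of that interval. This is the place where a
  uniform bound on the exponents enters.
\<close>

lemma countable_discontinuities_of_finite_variation:
  assumes exponent: "\<And>s t. a \<le> s \<Longrightarrow> s < t \<Longrightarrow> t \<le> b \<Longrightarrow>
      0 \<le> mean_exponent p s t \<and> mean_exponent p s t \<le> M"
    and finite: "wiener_variation a b p f < \<infinity>"
  shows "countable {x \<in> {a..b}. \<not> continuous (at x within {a..b}) f}"
proof -
  define \<phi> where "\<phi> x = enn2real (wiener_variation a x p f)" for x
  have \<phi>: "wiener_variation a x p f = ennreal (\<phi> x)" if "x \<in> {a..b}" for x
    using wiener_variation_mono[of a x b p f] finite that unfolding \<phi>_def
    by (metis atLeastAtMost_iff ennreal_enn2real infinity_ennreal_def order_le_less_trans)
  have \<phi>_nonneg: "0 \<le> \<phi> x" for x by (simp add: \<phi>_def)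
  have increment: "\<bar>f t - f s\<bar> powr mean_exponent p s t \<le> \<phi> t - \<phi> s"
    if "a \<le> s" "s < t" "t \<le> b" for s t
  proof -
    have "ennreal (\<phi> s + \<bar>f t - f s\<bar> powr mean_exponent p s t) \<le> ennreal (\<phi> t)"
      using wiener_variation_superadditive[of a s t p f] that \<phi>[of s] \<phi>[of t] \<phi>_nonneg[of s]
      by (simp add: ennreal_plus)
    then show ?thesis using \<phi>_nonneg[of t] by (simp add: ennreal_le_iff)
  qed
  have "mono_on {a..b} \<phi>"
  proof (rule mono_onI)
    fix s t assume "s \<in> {a..b}" "t \<in> {a..b}" "s \<le> t"
    then show "\<phi> s \<le> \<phi> t"
      using order_trans[OF powr_ge_zero increment[of s t]]
      by (cases "s = t") simp_all
  qed
  then have "countable {x \<in> {a..b}. \<not> continuous (at x within {a..b}) \<phi>}"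
    by (rule mono_on_ctble_discont)
  moreover have "continuous (at x within {a..b}) f"
    if x: "x \<in> {a..b}" and cont: "continuous (at x within {a..b}) \<phi>" for x
    unfolding continuous_within_eps_delta
  proof (intro allI impI)
    fix e :: real assume "0 < e"
    \<comment> \<open>For a base below \<open>1\<close> the power decreases in the exponent, so \<open>c powr M\<close> is a lower
      bound for all powers of \<open>c\<close> that occur.\<close>
    define c where "c = min e (1 / 2)"
    have c: "0 < c" "c < 1" "c \<le> e" using \<open>0 < e\<close> by (auto simp: c_def)
    then obtain d where "d > 0"
      and d: "\<And>y. y \<in> {a..b} \<Longrightarrow> dist y x < d \<Longrightarrow> dist (\<phi> y) (\<phi> x) < c powr M"
      using cont unfolding continuous_within_eps_delta by (metis powr_gt_zero less_numeral_extra(3))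
    have small: "\<bar>f t - f s\<bar> < c"
      if "a \<le> s" "s < t" "t \<le> b" "\<phi> t - \<phi> s < c powr M" for s t
    proof (rule ccontr)
      assume "\<not> ?thesis"
      then have "c powr mean_exponent p s t \<le> \<bar>f t - f s\<bar> powr mean_exponent p s t"
        using c exponent[of s t] that by (intro powr_mono2) auto
      moreover have "c powr M \<le> c powr mean_exponent p s t"
        using c exponent[of s t] that by (intro powr_mono') auto
      ultimately show False using increment[of s t] that by linarith
    qed
    have "dist (f y) (f x) < e" if "y \<in> {a..b}" "dist y x < d" for y
      using small[of x y] small[of y x] d[OF that] x that c \<open>0 < e\<close>
      by (cases y x rule: linorder_cases) (auto simp: dist_real_def abs_less_iff)
    then show "\<exists>d>0. \<forall>y\<in>{a..b}. dist y x < d \<longrightarrow> dist (f y) (f x) < e"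
      using \<open>d > 0\<close> by blast
  qed
  ultimately show ?thesis
    by (elim countable_subset[rotated]) auto
qed

theorem theorem2p10:
  fixes a b :: real and p f :: "real \<Rightarrow> real"
  assumes "a < b"
    and "\<And>x. x \<in> {a..b} \<Longrightarrow> 1 \<le> p x"
    and "set_integrable lebesgue {a..b} p"
    and "essentially_bounded_on {a..b} p"
    and "f \<in> WBV a b p"
  shows "countable {x \<in> {a..b}. \<not> continuous (at x within {a..b}) f}"
proof -
  obtain N where N: "AE x in lebesgue. x \<in> {a..b} \<longrightarrow> \<bar>p x\<bar> \<le> N"
    using assms(4) unfolding essentially_bounded_on_def by blast
  \<comment> \<open>The maximum with \<open>1\<close> only ensures that the bound is positive.\<close>
  define M where "M = max 1 N"
  have M: "AE x in lebesgue. x \<in> {s..t} \<longrightarrow> p x \<le> M" if "a \<le> s" "t \<le> b" for s t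
    using N by eventually_elim (use that in \<open>auto simp: M_def\<close>)
  have meas: "set_borel_measurable lebesgue {s..t} p" if "a \<le> s" "t \<le> b" for s t
  proof -
    have "set_integrable lebesgue {s..t} p"
      by (rule set_integrable_subset[OF assms(3)]) (use that in auto)
    then show ?thesis
      by (simp add: set_integrable_def set_borel_measurable_def)
  qed
  have exponent: "0 \<le> mean_exponent p s t \<and> mean_exponent p s t \<le> M"
    if "a \<le> s" "s < t" "t \<le> b" for s t
  proof
    have p: "1 \<le> p x" if "x \<in> {s..t}" for x
      using assms(2)[of x] that \<open>a \<le> s\<close> \<open>t \<le> b\<close> by simp
    show "0 \<le> mean_exponent p s t"
      using p by (intro mean_exponent_nonneg \<open>s < t\<close>) (meson order_trans zero_le_one)
    show "mean_exponent p s t \<le> M"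
      by (rule mean_exponent_le[OF \<open>s < t\<close> p meas M]) (use that in \<open>auto simp: M_def\<close>)
  qed
  have "{ennreal l | l :: real. l > 0 \<and> wiener_variation a b p (\<lambda>x. f x / l) \<le> 1} \<noteq> {}"
    (is "?L \<noteq> {}")
  proof
    assume "?L = {}"
    then have "wbv_norm a b p f = Inf {}"
      unfolding wbv_norm_def by (rule arg_cong)
    then show False
      using assms(5) by (simp add: WBV_def)
  qed
  then obtain l where l: "l > 0" "wiener_variation a b p (\<lambda>x. f x / l) \<le> 1"
    by blast
  have "wiener_variation a b p (\<lambda>x. f x / l) < \<infinity>"
    using l(2) ennreal_one_less_top by (simp add: order_le_less_trans)
  with exponent have "countable {x \<in> {a..b}. \<not> continuous (at x within {a..b}) (\<lambda>x. f x / l)}"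
    by (rule countable_discontinuities_of_finite_variation)
  moreover have "continuous (at x within {a..b}) f"
    if "continuous (at x within {a..b}) (\<lambda>x. f x / l)" for x
    using continuous_mult_left[OF that, of l] l(1) by simp
  ultimately show ?thesis
    by (elim countable_subset[rotated]) auto
qed

end
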